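(* Let $\ell\in\mathbb N$. There exists an obtuse lattice triangle of lattice perimeter $\ell$ whose centroid is a lattice point if and only if $\ell\ge 3$ and $\ell\notin\{5,11\}$.
   Context: $\mathbb N$ denotes the positive integers. A lattice point is an element of $\mathbb Z^2\subseteq\mathbb R^2$. A lattice triangle is a (nondegenerate) triangle in $\mathbb R^2$ whose three vertices are lattice points. The lattice length of a segment joining two lattice points is the number of lattice points on the segment (endpoints included) minus one. The lattice perimeter of a lattice triangle is the sum of the lattice lengths of its three sides. A triangle is obtuse if one of its interior angles is strictly greater than $\pi/2$. *)

theory Defs
  imports "HOL-Analysis.Analysis"
begin

definition lattice_point :: "real^2 \<Rightarrow> bool" where
  "lattice_point p \<longleftrightarrow> (\<forall>i. p $ i \<in> \<int>)"

text \<open>A triangle is given by its three vertices; nondegenerate means that they are not collinear.\<close>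

definition lattice_triangle :: "real^2 \<Rightarrow> real^2 \<Rightarrow> real^2 \<Rightarrow> bool" where
  "lattice_triangle A B C \<longleftrightarrow>
     lattice_point A \<and> lattice_point B \<and> lattice_point C \<and> \<not> collinear {A, B, C}"

definition lattice_length :: "real^2 \<Rightarrow> real^2 \<Rightarrow> nat" where
  "lattice_length A B = card {p \<in> closed_segment A B. lattice_point p} - 1"

definition lattice_perimeter :: "real^2 \<Rightarrow> real^2 \<Rightarrow> real^2 \<Rightarrow> nat" where
  "lattice_perimeter A B C = lattice_length A B + lattice_length B C + lattice_length C A"

definition centroid :: "real^2 \<Rightarrow> real^2 \<Rightarrow> real^2 \<Rightarrow> real^2" where
  "centroid A B C = (1 / 3) *\<^sub>R (A + B + C)"

text \<open>The angle at the middle argument, in \<open>[0, pi]\<close>; only meaningful if \<open>A \<noteq> B\<close> and \<open>C \<noteq> B\<close>.\<close>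

definition interior_angle :: "real^2 \<Rightarrow> real^2 \<Rightarrow> real^2 \<Rightarrow> real" where
  "interior_angle A B C = arccos (((A - B) \<bullet> (C - B)) / (norm (A - B) * norm (C - B)))"

definition obtuse :: "real^2 \<Rightarrow> real^2 \<Rightarrow> real^2 \<Rightarrow> bool" where
  "obtuse A B C \<longleftrightarrow>
     interior_angle C A B > pi / 2 \<or> interior_angle A B C > pi / 2 \<or> interior_angle B C A > pi / 2"

end

(* Up to sign, the edge vectors u, v, w = -(u + v) of a lattice triangle have gcds a, b, c, whose sum is
   the perimeter. Every common divisor of two of a, b, c divides the third. The centroid is a lattice point
   iff u, v, w are congruent modulo 3, so either all of a, b, c are divisible by 3 or none is; this rules
   out the perimeters 5 and 11. Conversely, for coprime b, c prime to 3, the edges (b, 0) and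
   (b c^2, 3 c) give an obtuse triangle with side lengths b, c, 1, and every remaining
   perimeter is of the form b + c + 1. *)
theory Submission
  imports Defs
begin

section \<open>Lattice points on a segment\<close>

lemma lattice_point_iff_of_int:
  "lattice_point p \<longleftrightarrow> (\<exists>x y :: int. p = vector [of_int x, of_int y])"
proof
  assume "lattice_point p"
  then obtain x y where "p $ 1 = of_int x" "p $ 2 = of_int y"
    unfolding lattice_point_def by (metis Ints_cases)
  then have "p = vector [of_int x, of_int y]"
    by (simp add: vec_eq_iff forall_2)
  then show "\<exists>x y :: int. p = vector [of_int x, of_int y]"
    by blast
qed (auto simp: lattice_point_def forall_2)

text \<open>Dividing \<open>(m, n)\<close> by \<open>g = gcd m n\<close> leaves a primitive vector
  \<open>(m', n')\<close>, and the lattice points of the segment are exactly the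
  \<open>g + 1\<close> points reached from \<open>A\<close> by \<open>0, ..., g\<close> such steps.
  If \<open>g = 0\<close>, the segment is one point and both sides are \<open>0\<close>.\<close>

lemma lattice_length_eq_gcd:
  fixes a b m n :: int
  assumes A: "A = vector [of_int a, of_int b]"
    and B: "B = vector [of_int (a + m), of_int (b + n)]"
  shows "lattice_length A B = nat (gcd m n)"
proof (cases "gcd m n = 0")
  case True
  then have "B = A"
    using A B by simp
  moreover have "{p \<in> {A}. lattice_point p} = {A}"
    using A lattice_point_iff_of_int by auto
  ultimately show ?thesis
    using True by (simp add: lattice_length_def)
next
  case False
  define g where "g = nat (gcd m n)"
  have g: "int g = gcd m n" "g > 0"
    using False by (auto simp: g_def simp del: gcd_eq_0_iff)
  obtain m' n' where mn: "m = int g * m'" "n = int g * n'"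
    using g(1) by (metis dvdE gcd_dvd1 gcd_dvd2)
  obtain x y where bez: "x * m + y * n = int g"
    using bezout_int g(1) by metis
  define f where "f k = (vector [of_int (a + int k * m'), of_int (b + int k * n')] :: real^2)" for k
  have "{p \<in> closed_segment A B. lattice_point p} = f ` {0..g}"
  proof (intro equalityI subsetI)
    fix p assume "p \<in> {p \<in> closed_segment A B. lattice_point p}"
    then obtain t r s where t: "0 \<le> t" "t \<le> 1" "p = (1 - t) *\<^sub>R A + t *\<^sub>R B"
      and p: "p = vector [of_int r, of_int s]"
      unfolding in_segment lattice_point_iff_of_int by blast
    have "p $ 1 = of_int a + t * of_int m" "p $ 2 = of_int b + t * of_int n"
      unfolding t(3) A B by (simp_all add: algebra_simps)
    then have rs: "of_int (r - a) = t * of_int m" "of_int (s - b) = t * of_int n"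
      using p by simp_all
    \<comment> \<open>Both \<open>t * m\<close> and \<open>t * n\<close> are integers, so the Bezout
      combination makes \<open>t * g\<close> an integer as well; thus \<open>t = k / g\<close> for
      some \<open>k\<close> between \<open>0\<close> and \<open>g\<close>.\<close>
    have tg: "t * of_nat g = of_int (x * (r - a) + y * (s - b))"
    proof -
      have "t * of_nat g = t * of_int (x * m + y * n)"
        using bez by simp
      also have "\<dots> = of_int x * (t * of_int m) + of_int y * (t * of_int n)"
        by (simp add: algebra_simps)
      finally show ?thesis
        unfolding rs[symmetric] by simp
    qed
    define k where "k = nat (x * (r - a) + y * (s - b))"
    have "0 \<le> t * of_nat g" "t * of_nat g \<le> of_nat g"
      using t by (simp_all add: mult_left_le_one_le)
    then have "0 \<le> x * (r - a) + y * (s - b)" "x * (r - a) + y * (s - b) \<le> int g"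
      unfolding tg by linarith+
    then have k: "t * of_nat g = of_nat k" "k \<le> g"
      using tg by (simp_all add: k_def)
    have "real_of_int (r - a) = of_int (int k * m')"
      unfolding rs mn using k(1) by simp
    moreover have "real_of_int (s - b) = of_int (int k * n')"
      unfolding rs mn using k(1) by simp
    ultimately have "r = a + int k * m'" "s = b + int k * n'"
      unfolding of_int_eq_iff by simp_all
    then show "p \<in> f ` {0..g}"
      using p k(2) by (auto simp: f_def)
  next
    fix p assume "p \<in> f ` {0..g}"
    then obtain k where k: "k \<le> g" "p = f k"
      by auto
    have "p = (1 - of_nat k / of_nat g) *\<^sub>R A + (of_nat k / of_nat g) *\<^sub>R B"
      using g(2) by (simp add: k f_def A B mn vec_eq_iff forall_2 field_simps)
    moreover have "lattice_point p"
      unfolding lattice_point_iff_of_int k(2) f_def by blast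
    moreover have "real k / real g \<le> 1"
      using k(1) g(2) by simp
    ultimately show "p \<in> {p \<in> closed_segment A B. lattice_point p}"
      unfolding in_segment by (auto intro!: exI[of _ "real k / real g"])
  qed
  moreover have "inj_on f {0..g}"
  proof (rule inj_onI)
    fix i j assume "f i = f j"
    then have "f i $ 1 = f j $ 1" "f i $ 2 = f j $ 2"
      by simp_all
    then have "int i * m' = int j * m'" "int i * n' = int j * n'"
      unfolding f_def by (simp_all only: vector_2 of_int_eq_iff)
    moreover have "m' \<noteq> 0 \<or> n' \<noteq> 0"
      using False mn by auto
    ultimately show "i = j"
      by auto
  qed
  ultimately show ?thesis
    unfolding lattice_length_def by (simp add: card_image g_def)
qed

section \<open>Necessity: divisibility among the edge gcds\<close>

text \<open>Modulo 3 the third vector is \<open>(2 * p, 2 * q)\<close> and 2 is invertible, so each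
  of the three conditions amounts to \<open>3 dvd p\<close> and \<open>3 dvd q\<close>.\<close>

lemma three_dvd_each_gcd:
  fixes p q r s :: int
  assumes "3 dvd r - p" "3 dvd s - q"
    and "3 dvd gcd p q \<or> 3 dvd gcd r s \<or> 3 dvd gcd (p + r) (q + s)"
  shows "3 dvd gcd p q" "3 dvd gcd r s" "3 dvd gcd (p + r) (q + s)"
proof -
  have "3 dvd p \<and> 3 dvd q"
    using assms by (simp only: gcd_greatest_iff) presburger
  then show "3 dvd gcd p q" "3 dvd gcd r s" "3 dvd gcd (p + r) (q + s)"
    using assms(1,2) by (simp_all only: gcd_greatest_iff) presburger+
qed

text \<open>Neither 5 nor 11 is a multiple of 3, so none of \<open>a\<close>, \<open>b\<close>,
  \<open>c\<close> is; in each of the few splittings that remain, 2 or 5 divides exactly two of the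
  three parts.\<close>

lemma gcd_sum_edges_neq_5_11:
  fixes p q r s :: int
  defines "a \<equiv> nat (gcd p q)" and "b \<equiv> nat (gcd r s)" and "c \<equiv> nat (gcd (p + r) (q + s))"
  assumes cong: "3 dvd r - p" "3 dvd s - q"
    and pos: "a > 0" "b > 0" "c > 0"
  shows "a + b + c \<notin> {5, 11}"
proof
  assume sum: "a + b + c \<in> {5, 11}"
  have int_eqs: "int a = gcd p q" "int b = gcd r s" "int c = gcd (p + r) (q + s)"
    by (simp_all add: a_def b_def c_def)
  have not3: "\<not> 3 dvd a" "\<not> 3 dvd b" "\<not> 3 dvd c"
  proof -
    have "\<not> (3 dvd int a \<or> 3 dvd int b \<or> 3 dvd int c)"
    proof
      assume "3 dvd int a \<or> 3 dvd int b \<or> 3 dvd int c"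
      then have "3 dvd int a" "3 dvd int b" "3 dvd int c"
        unfolding int_eqs using three_dvd_each_gcd[OF cong] by blast+
      then have "3 dvd a + b + c"
        by presburger
      then show False
        using sum by auto
    qed
    then show "\<not> 3 dvd a" "\<not> 3 dvd b" "\<not> 3 dvd c"
      by presburger+
  qed
  have "d dvd gcd p q \<Longrightarrow> d dvd gcd r s \<Longrightarrow> d dvd gcd (p + r) (q + s)"
    "d dvd gcd p q \<Longrightarrow> d dvd gcd (p + r) (q + s) \<Longrightarrow> d dvd gcd r s"
    "d dvd gcd r s \<Longrightarrow> d dvd gcd (p + r) (q + s) \<Longrightarrow> d dvd gcd p q" for d
    by (simp_all add: dvd_add_right_iff dvd_add_left_iff)
  then have "int d dvd int a \<Longrightarrow> int d dvd int b \<Longrightarrow> int d dvd int c"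
    "int d dvd int a \<Longrightarrow> int d dvd int c \<Longrightarrow> int d dvd int b"
    "int d dvd int b \<Longrightarrow> int d dvd int c \<Longrightarrow> int d dvd int a" for d
    unfolding int_eqs by blast+
  then have third: "d dvd a \<Longrightarrow> d dvd b \<Longrightarrow> d dvd c"
    "d dvd a \<Longrightarrow> d dvd c \<Longrightarrow> d dvd b" "d dvd b \<Longrightarrow> d dvd c \<Longrightarrow> d dvd a" for d
    unfolding of_nat_dvd_iff by blast+
  have "a < 11" "b < 11" "c < 11"
    using sum pos by auto
  then have "a \<in> {1,2,4,5,7,8,10}" "b \<in> {1,2,4,5,7,8,10}"
    using not3 pos by (simp_all, presburger+)
  moreover have "c = 5 - (a + b) \<or> c = 11 - (a + b)"
    using sum by auto
  \<comment> \<open>Up to order the candidates are 1+2+2 for 5, and 1+2+8, 2+2+7, 2+4+5, 1+5+5 for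
    11. The divisor 5 refutes the last one, the divisor 2 all others.\<close>
  ultimately show False
    using third[of 2] third[of 5] not3 pos by auto
qed

lemma gcds_of_lattice_centroid_triangle:
  assumes tri: "lattice_triangle A B C" and cen: "lattice_point (centroid A B C)"
  obtains p q r s :: int where
    "3 dvd r - p" "3 dvd s - q"
    "gcd p q > 0" "gcd r s > 0" "gcd (p + r) (q + s) > 0"
    "lattice_perimeter A B C = nat (gcd p q) + nat (gcd r s) + nat (gcd (p + r) (q + s))"
proof -
  obtain a1 a2 b1 b2 c1 c2 :: int where
    A: "A = vector [of_int a1, of_int a2]" and B: "B = vector [of_int b1, of_int b2]"
    and C: "C = vector [of_int c1, of_int c2]"
    using tri unfolding lattice_triangle_def lattice_point_iff_of_int by blast
  obtain z1 z2 :: int where "centroid A B C = vector [of_int z1, of_int z2]"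
    using cen unfolding lattice_point_iff_of_int by blast
  then have "centroid A B C $ 1 = of_int z1" "centroid A B C $ 2 = of_int z2"
    by simp_all
  then have "real_of_int (a1 + b1 + c1) = of_int (3 * z1)" "real_of_int (a2 + b2 + c2) = of_int (3 * z2)"
    unfolding centroid_def A B C by simp_all
  then have z: "a1 + b1 + c1 = 3 * z1" "a2 + b2 + c2 = 3 * z2"
    unfolding of_int_eq_iff .
  define p q r s where "p = b1 - a1" and "q = b2 - a2" and "r = c1 - b1" and "s = c2 - b2"
  note defs = p_def q_def r_def s_def
  have ncol: "A \<noteq> B" "B \<noteq> C" "C \<noteq> A"
    using tri by (auto simp: lattice_triangle_def insert_commute)
  have step: "b1 = a1 + p" "b2 = a2 + q" "c1 = b1 + r" "c2 = b2 + s"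
    and closing: "a1 = c1 + - (p + r)" "a2 = c2 + - (q + s)"
    by (simp_all add: defs)
  have len_AB: "lattice_length A B = nat (gcd p q)"
    by (rule lattice_length_eq_gcd[OF A]) (simp only: B step(1,2))
  have len_BC: "lattice_length B C = nat (gcd r s)"
    by (rule lattice_length_eq_gcd[OF B]) (simp only: C step(3,4))
  have len_CA: "lattice_length C A = nat (gcd (- (p + r)) (- (q + s)))"
    by (rule lattice_length_eq_gcd[OF C]) (simp only: A closing)
  show thesis
  proof (rule that)
    \<comment> \<open>Here \<open>r - p = a1 + c1 - 2 * b1 = 3 * (z1 - b1)\<close>, and likewise for
      the second coordinate.\<close>
    show "3 dvd r - p" "3 dvd s - q"
      using z unfolding defs by presburger+
    show "gcd p q > 0" "gcd r s > 0" "gcd (p + r) (q + s) > 0"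
      using ncol by (auto simp: A B C defs)
    show "lattice_perimeter A B C = nat (gcd p q) + nat (gcd r s) + nat (gcd (p + r) (q + s))"
      unfolding lattice_perimeter_def len_AB len_BC len_CA gcd_neg1_int gcd_neg2_int ..
  qed
qed

section \<open>Sufficiency: an obtuse triangle with prescribed edge gcds\<close>

text \<open>The cosine of the angle is negative, and \<open>arccos\<close> is strictly decreasing
  with value \<open>pi / 2\<close> at 0. Cauchy-Schwarz keeps the argument inside the domain where
  this monotonicity holds.\<close>

lemma interior_angle_gt_pi_half:
  assumes "(A - B) \<bullet> (C - B) < 0"
  shows "interior_angle A B C > pi / 2"
proof -
  define x where "x = (A - B) \<bullet> (C - B) / (norm (A - B) * norm (C - B))"
  have pos: "norm (A - B) * norm (C - B) > 0"
    using assms by (auto simp: zero_less_mult_iff)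
  then have "x < 0"
    using assms by (simp add: x_def divide_neg_pos)
  moreover have "- 1 \<le> x"
    using pos Cauchy_Schwarz_ineq2[of "A - B" "C - B"] by (simp add: x_def le_divide_eq abs_le_iff)
  ultimately have "arccos 0 < arccos x"
    by (intro arccos_less_arccos) auto
  then show ?thesis
    by (simp add: interior_angle_def x_def)
qed

text \<open>For collinear points both edge vectors are multiples of one vector, so their determinant
  vanishes.\<close>

lemma not_collinear_of_det:
  fixes A B C :: "real^2"
  assumes "(B $ 1 - A $ 1) * (C $ 2 - B $ 2) \<noteq> (B $ 2 - A $ 2) * (C $ 1 - B $ 1)"
  shows "\<not> collinear {A, B, C}"
proof
  assume "collinear {A, B, C}"
  then obtain u where "\<forall>x\<in>{A, B, C}. \<forall>y\<in>{A, B, C}. \<exists>c. x - y = c *\<^sub>R u"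
    unfolding collinear_def by blast
  then obtain c d where "B - A = c *\<^sub>R u" "C - B = d *\<^sub>R u"
    by (metis insertI1 insertI2)
  then have "B $ i - A $ i = c * u $ i" "C $ i - B $ i = d * u $ i" for i
    by (simp_all flip: vector_minus_component)
  then show False
    using assms by simp
qed

lemma coprime_prime_right:
  fixes p n :: "'a :: factorial_semiring_gcd"
  assumes "prime p" "\<not> p dvd n"
  shows "coprime n p"
  using prime_imp_coprime[OF assms] by (simp add: coprime_commute)

lemma obtuse_triangle_of_coprime:
  fixes b c :: nat
  assumes pos: "b > 0" "c > 0" and cop: "coprime b c" and not3: "\<not> 3 dvd b" "\<not> 3 dvd c"
  shows "\<exists>A B C. lattice_triangle A B C \<and> obtuse A B C \<and>
    lattice_perimeter A B C = 1 + b + c \<and> lattice_point (centroid A B C)"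
proof -
  define x y where "x = int b" and "y = int c"
  have xy: "x > 0" "y > 0" "coprime x y"
    using pos cop by (simp_all add: x_def y_def)
  have n3: "\<not> 3 dvd x" "\<not> 3 dvd y"
    using not3 unfolding x_def y_def by presburger+
  have cop3: "coprime x 3" "coprime y 3"
    using n3 by (auto intro: coprime_prime_right)
  \<comment> \<open>This congruence serves twice: it makes \<open>1 + y^2\<close> prime to 3, for
    the edge of length 1, and \<open>y^2 - 1\<close> divisible by 3, for the centroid.\<close>
  have y2: "y ^ 2 mod 3 = 1"
  proof -
    have "y mod 3 = 1 \<or> y mod 3 = 2"
      using n3(2) by presburger
    then show ?thesis
      by (auto simp: power_mod[symmetric, of y])
  qed
  define A B C :: "real^2" where "A = vector [of_int (- x), of_int 0]"
    and "B = vector [of_int 0, of_int 0]"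
    and "C = vector [of_int (x * y^2), of_int (3 * y)]"
  note ABC = A_def B_def C_def
  have "lattice_length A B = nat (gcd x 0)"
    by (rule lattice_length_eq_gcd[OF A_def]) (simp add: B_def)
  moreover have "lattice_length B C = nat (gcd (x * y^2) (3 * y))"
    by (rule lattice_length_eq_gcd[OF B_def]) (simp add: C_def)
  moreover have "lattice_length C A = nat (gcd (- (x * (1 + y^2))) (- (3 * y)))"
    by (rule lattice_length_eq_gcd[OF C_def]) (simp add: A_def algebra_simps)
  \<comment> \<open>After the common factor \<open>y\<close> is split off, the cofactors
    \<open>x * y\<close> and \<open>3\<close> are coprime.\<close>
  moreover have "gcd (x * y^2) (3 * y) = y"
  proof -
    have "coprime (x * y) 3"
      using cop3 by simp
    then have "gcd (y * (x * y)) (y * 3) = y"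
      using xy(2) by (simp add: gcd_mult_left del: coprime_mult_left_iff)
    then show ?thesis
      by (simp add: power2_eq_square ac_simps)
  qed
  \<comment> \<open>Each of the factors \<open>x\<close> and \<open>1 + y^2\<close> is coprime to
    both \<open>3\<close> and \<open>y\<close>.\<close>
  moreover have "gcd (x * (1 + y^2)) (3 * y) = 1"
  proof -
    have "\<not> 3 dvd 1 + y^2"
      using y2 by presburger
    then have "coprime (1 + y^2) 3"
      by (auto intro: coprime_prime_right)
    moreover have "coprime (1 + y^2) y"
      by (rule coprimeI) (simp add: power2_eq_square dvd_add_left_iff dvd_mult)
    ultimately show ?thesis
      using xy(3) cop3 by simp
  qed
  ultimately have "lattice_perimeter A B C = nat x + nat y + 1"
    using xy by (simp add: lattice_perimeter_def)
  then have "lattice_perimeter A B C = 1 + b + c"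
    by (simp add: x_def y_def)
  moreover have "lattice_triangle A B C"
    unfolding lattice_triangle_def
  proof (intro conjI not_collinear_of_det)
    show "lattice_point A" "lattice_point B" "lattice_point C"
      unfolding lattice_point_iff_of_int ABC by blast+
    show "(B $ 1 - A $ 1) * (C $ 2 - B $ 2) \<noteq> (B $ 2 - A $ 2) * (C $ 1 - B $ 1)"
      using xy by (simp add: ABC)
  qed
  \<comment> \<open>The obtuse angle is at the origin \<open>B\<close>: \<open>A\<close> lies on the
    negative horizontal axis and \<open>C\<close> has positive first coordinate.\<close>
  moreover have "obtuse A B C"
  proof -
    have "(A - B) \<bullet> (C - B) = - of_int (x * (x * y^2))"
      by (simp add: ABC inner_vec_def sum_2)
    also have "\<dots> < 0"
      using xy by simp
    finally show ?thesis
      unfolding obtuse_def using interior_angle_gt_pi_half by blast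
  qed
  moreover have "lattice_point (centroid A B C)"
  proof -
    have "3 dvd y^2 - 1"
      using y2 by presburger
    then obtain k where "y^2 - 1 = 3 * k" ..
    then have k: "y^2 = 3 * k + 1"
      by simp
    have "centroid A B C = vector [of_int (x * k), of_int y]"
      by (simp add: centroid_def ABC k vec_eq_iff forall_2 algebra_simps)
    then show ?thesis
      unfolding lattice_point_iff_of_int by blast
  qed
  ultimately show ?thesis
    by blast
qed

section \<open>Splitting the perimeter into admissible side lengths\<close>

text \<open>The simplest split, \<open>1\<close> and \<open>l - 2\<close>, fails only if 3 divides
  \<open>l - 2\<close>. Then \<open>2\<close> and \<open>l - 3\<close> works for even
  \<open>l\<close>. For odd \<open>l\<close>, that is \<open>l mod 12\<close> equal to 5 or 11, two
  nearly equal odd parts are taken; the smallest such \<open>l\<close> allowed is 17.\<close>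

lemma coprime_parts_exist:
  fixes l :: nat
  assumes "l \<ge> 3" "l \<noteq> 5" "l \<noteq> 11"
  obtains b c :: nat where "b > 0" "c > 0" "coprime b c" "\<not> 3 dvd b" "\<not> 3 dvd c" "l = 1 + b + c"
proof -
  have "l mod 3 \<noteq> 2 \<or> l mod 6 = 2 \<or> l mod 12 = 5 \<or> l mod 12 = 11"
    by presburger
  then consider "l mod 3 \<noteq> 2" | "l mod 6 = 2" | "l mod 12 \<in> {5, 11}"
    by blast
  then show thesis
  proof cases
    case 1
    moreover have "\<not> 3 dvd l - 2"
      using 1 assms(1) by presburger
    ultimately show thesis
      using assms by (intro that[of 1 "l - 2"]) auto
  next
    case 2
    moreover have "\<not> 3 dvd l - 3" "odd (l - 3)" "l > 3"
      using 2 assms(1) by presburger+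
    ultimately show thesis
      by (intro that[of 2 "l - 3"]) auto
  next
    case 3
    \<comment> \<open>The parts are \<open>h - d\<close> and \<open>h + d\<close> for \<open>h = (l - 1) / 2\<close>, where \<open>d = 3\<close> if \<open>h\<close> is even and \<open>d = 6\<close> if
      \<open>h\<close> is odd, so that both are odd and their gcd divides \<open>2 * d\<close>.\<close>
    have "l div 12 \<noteq> 0"
      using 3 assms mult_div_mod_eq[of 12 l] by (intro notI) auto
    then obtain k where k: "l div 12 = Suc k"
      using not0_implies_Suc by blast
    \<comment> \<open>The smaller part is the same in both classes: \<open>l = 12 * k + 17\<close>
      has midpoint \<open>6 * k + 8\<close> and offset 3, while \<open>l = 12 * k + 23\<close> has
      midpoint \<open>6 * k + 11\<close> and offset 6. It is prime to 6, hence coprime to the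
      differences 6 and 12.\<close>
    define b where "b = 6 * k + 5"
    have l: "l = 1 + b + (b + 6) \<or> l = 1 + b + (b + 12)"
      using 3 mult_div_mod_eq[of 12 l] unfolding b_def k by auto
    have b: "b > 0" "odd b" "\<not> 3 dvd b" "\<not> 3 dvd b + 6" "\<not> 3 dvd b + 12"
      unfolding b_def by presburger+
    have "coprime b 2" "coprime b 3"
      using b(2,3) by (auto intro: coprime_prime_right)
    then have "coprime b (2 * 3)" "coprime b (2 * (2 * 3))"
      unfolding coprime_mult_right_iff by blast+
    then have "coprime b (b + 6)" "coprime b (b + 12)"
      by (simp_all add: coprime_iff_gcd_eq_1)
    then show thesis
      using l b that[of b "b + 6"] that[of b "b + 12"] by auto
  qed
qed

theorem mainTheorem6:
  fixes l :: nat
  assumes "l \<ge> 1"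
  shows "(\<exists>A B C. lattice_triangle A B C \<and> obtuse A B C \<and>
            lattice_perimeter A B C = l \<and> lattice_point (centroid A B C))
         \<longleftrightarrow> l \<ge> 3 \<and> l \<notin> {5, 11}"
proof
  assume "\<exists>A B C. lattice_triangle A B C \<and> obtuse A B C \<and>
            lattice_perimeter A B C = l \<and> lattice_point (centroid A B C)"
  then obtain A B C where "lattice_triangle A B C" "lattice_point (centroid A B C)"
    and l: "lattice_perimeter A B C = l"
    by blast
  then obtain p q r s :: int where cong: "3 dvd r - p" "3 dvd s - q"
    and pos: "gcd p q > 0" "gcd r s > 0" "gcd (p + r) (q + s) > 0"
    and per: "lattice_perimeter A B C = nat (gcd p q) + nat (gcd r s) + nat (gcd (p + r) (q + s))"
    using gcds_of_lattice_centroid_triangle by metis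
  have pos': "nat (gcd p q) > 0" "nat (gcd r s) > 0" "nat (gcd (p + r) (q + s)) > 0"
    using pos by (simp_all only: zero_less_nat_eq)
  then have "l \<ge> 3"
    using per l by linarith
  moreover have "l \<notin> {5, 11}"
    using gcd_sum_edges_neq_5_11[OF cong pos'] per l by simp
  ultimately show "l \<ge> 3 \<and> l \<notin> {5, 11}" ..
next
  assume "l \<ge> 3 \<and> l \<notin> {5, 11}"
  then show "\<exists>A B C. lattice_triangle A B C \<and> obtuse A B C \<and>
            lattice_perimeter A B C = l \<and> lattice_point (centroid A B C)"
    using coprime_parts_exist[of l] obtuse_triangle_of_coprime by (metis insertCI)
qed

end
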